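(* Let $n,s_1,s_2$ be integers such that $0\le s_1<s_2<n$. Put $s=s_2-s_1$, $d=(n,s)=\gcd(n,s)$ and $m=n\backslash s=n/\gcd(n,s)$. Let $a,b$ be non-zero complex numbers such that $a^{m}-(-b)^{m}=0$. Then $$\left(aP_n^{s_1}+bP_n^{s_2}\right)^{D}=P_n^{\,n-s_1}\,P_{\sigma_{n,s}}\left[I_{d}\otimes\left(aI_{m}+bP_{m}\right)^{D}\right]P_{\sigma_{n,s}}^{T}.$$
   Context: Indices of $n\times n$ matrices run over $[n]:=\{0,1,\dots,n-1\}$, and permutations are bijections of $[n]$. For a permutation $\alpha$ of $[n]$, $P_\alpha$ is the $n\times n$ matrix with $(P_\alpha)_{\alpha(j),j}=1$ for each $j$ and all other entries $0$. $P_n:=P_{\tau_n}$ where $\tau_n(i)=(i-1)\bmod n$; thus $(P_n)_{i,j}=1$ if $j\equiv i+1 \pmod n$ and $0$ otherwise. $I_n$ is the identity, $\otimes$ is the Kronecker product. For integers $0<s<n$, $(n,s)$ is the greatest common divisor and $n\backslash s:=n/(n,s)$. The permutation $\sigma_{n,s}$ of $[n]$ is $\sigma_{n,s}:=\widehat F_{n,s}\circ J_{n,s}$, where $J_{n,s}:[n]\to[(n,s)]\times[n\backslash s]$ is $J_{n,s}(i)=(\varrho_{n,s}(i),\ell_{n,s}(i))$ with $\varrho_{n,s}(i)=\max\{k\in[(n,s)]: i\ge k\,(n\backslash s)\}$ and $\ell_{n,s}(i)=(i-\varrho_{n,s}(i)\,(n\backslash s))\bmod (n\backslash s)$, and $\widehat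 F_{n,s}:[(n,s)]\times[n\backslash s]\to[n]$ is $\widehat F_{n,s}(x,y)=(sy+x)\bmod n$. The index of a square matrix $A$ is the smallest non-negative integer $k$ such that $A^k$ and $A^{k+1}$ have the same column space. If $A$ has index $k$, its Drazin inverse $A^D$ is the unique matrix with $AA^D=A^DA$, $A^{k+1}A^D=A^k$ and $A^DAA^D=A^D$. *)

theory Defs
  imports "Jordan_Normal_Form.VS_Connect"
begin

(* Square matrices have indices 0, ..., n - 1, as in Jordan_Normal_Form.Matrix. *)

definition perm_matrix :: "nat \<Rightarrow> (nat \<Rightarrow> nat) \<Rightarrow> 'a :: semiring_1 mat" where
  "perm_matrix n \<alpha> = mat n n (\<lambda>(i, j). if i = \<alpha> j then 1 else 0)"

(* The subtraction is done on integers: truncated subtraction would send 0 to 0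
   instead of n - 1. *)
definition cyc_perm :: "nat \<Rightarrow> nat \<Rightarrow> nat" where
  "cyc_perm n i = nat ((int i - 1) mod int n)"

definition cyc_matrix :: "nat \<Rightarrow> 'a :: semiring_1 mat" where
  "cyc_matrix n = perm_matrix n (cyc_perm n)"

definition kronecker :: "'a :: semiring_1 mat \<Rightarrow> 'a mat \<Rightarrow> 'a mat" (infixr \<open>\<otimes>\<^sub>K\<close> 70) where
  "A \<otimes>\<^sub>K B = mat (dim_row A * dim_row B) (dim_col A * dim_col B)
     (\<lambda>(i, j). A $$ (i div dim_row B, j div dim_col B) * B $$ (i mod dim_row B, j mod dim_col B))"

(* Usually written n \ s. *)
definition cofactor_gcd :: "nat \<Rightarrow> nat \<Rightarrow> nat" where
  "cofactor_gcd n s = n div gcd n s"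

definition rho :: "nat \<Rightarrow> nat \<Rightarrow> nat \<Rightarrow> nat" where
  "rho n s i = Max {k \<in> {0..<gcd n s}. i \<ge> k * cofactor_gcd n s}"

(* The natural-number subtraction is exact: rho n s i * cofactor_gcd n s \<le> i. *)
definition ell :: "nat \<Rightarrow> nat \<Rightarrow> nat \<Rightarrow> nat" where
  "ell n s i = (i - rho n s i * cofactor_gcd n s) mod cofactor_gcd n s"

definition J_map :: "nat \<Rightarrow> nat \<Rightarrow> nat \<Rightarrow> nat \<times> nat" where
  "J_map n s i = (rho n s i, ell n s i)"

definition F_hat :: "nat \<Rightarrow> nat \<Rightarrow> nat \<times> nat \<Rightarrow> nat" where
  "F_hat n s = (\<lambda>(x, y). (s * y + x) mod n)"

definition sigma_perm :: "nat \<Rightarrow> nat \<Rightarrow> nat \<Rightarrow> nat" where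
  "sigma_perm n s = F_hat n s \<circ> J_map n s"

definition mat_index :: "'a :: field mat \<Rightarrow> nat" where
  "mat_index A = (LEAST k. vec_space.col_space (dim_row A) (A ^\<^sub>m k)
                         = vec_space.col_space (dim_row A) (A ^\<^sub>m (k + 1)))"

(* Meaningful for square A only. *)
definition drazin_inverse :: "'a :: field mat \<Rightarrow> 'a mat" where
  "drazin_inverse A = (THE X. X \<in> carrier_mat (dim_row A) (dim_row A)
      \<and> A * X = X * A
      \<and> A ^\<^sub>m (mat_index A + 1) * X = A ^\<^sub>m mat_index A
      \<and> X * A * X = X)"

end

theory Submission
  imports Defs "HOL-Number_Theory.Cong"
begin

text \<open>Write \<open>P = P\<^sub>n\<close>, \<open>U = P\<^sub>\<sigma>\<close> and \<open>B = a I\<^sub>m + b P\<^sub>m\<close>. Evaluating \<open>\<sigma>\<close> shows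
  \<open>P\<^sup>s U = U (I\<^sub>d \<otimes> P\<^sub>m)\<close>, so that the given matrix is \<open>P\<^sup>s\<^sup>1\<close> times \<open>U (I\<^sub>d \<otimes> B) U\<^sup>T\<close>, and the two
  factors commute. Since \<open>P\<^sub>m\<close> has order dividing \<open>m\<close> and \<open>a\<^sup>m = (- b)\<^sup>m\<close>, the matrix \<open>B\<close> has a group
  inverse, i.e. a Drazin inverse of index at most 1. Group inverses are preserved by \<open>I\<^sub>d \<otimes> _\<close>,
  by similarity and by multiplication with a commuting invertible matrix.\<close>

section \<open>Group inverses and their identification with Drazin inverses\<close>

text \<open>A relation rather than an operator: witnesses can be carried through products and
  similarities first, and uniqueness identifies the final one with the Drazin inverse.\<close>

definition group_inverse :: "nat \<Rightarrow> 'a :: semiring_1 mat \<Rightarrow> 'a mat \<Rightarrow> bool" where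
  "group_inverse n A X \<longleftrightarrow> A \<in> carrier_mat n n \<and> X \<in> carrier_mat n n
     \<and> A * X = X * A \<and> A * X * A = A \<and> X * A * X = X"

text \<open>Both inverses yield the same idempotent, \<open>A * X = Y * A\<close>, and
  \<open>Y = Y * A * Y\<close> recovers the inverse from it.\<close>

lemma group_inverse_unique:
  fixes A :: "'a :: semiring_1 mat"
  assumes gi: "group_inverse n A X" and Y: "Y \<in> carrier_mat n n"
    and "A * Y = Y * A" "A * Y * A = A" "Y * A * Y = Y"
  shows "Y = X"
proof -
  note [simp] = mult_carrier_mat[of _ n n _ n]
  note assoc = assoc_mult_mat[of _ n n _ n _ n]
  have [simp]: "A \<in> carrier_mat n n" "X \<in> carrier_mat n n" "Y \<in> carrier_mat n n"
    using gi Y by (auto simp: group_inverse_def)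
  have AX: "A * X = X * A" "A * X * A = A" "X * A * X = X"
    using gi by (auto simp: group_inverse_def)
  have "A * X = (A * Y * A) * X" using assms by simp
  also have "\<dots> = (A * Y) * (A * X)" by (simp add: assoc)
  also have "\<dots> = (Y * A) * (X * A)" by (simp only: assms(3) AX(1))
  also have "\<dots> = Y * (A * X * A)" by (simp add: assoc)
  finally have E: "A * X = Y * A" using AX by simp
  have "Y = Y * A * Y" using assms by simp
  also have "\<dots> = X * A * Y" using E AX by simp
  also have "\<dots> = X * (A * Y)" by (simp add: assoc)
  also have "\<dots> = X * (A * X)" using E assms by simp
  also have "\<dots> = X" using AX by (simp add: assoc)
  finally show ?thesis .
qed

lemma col_space_subset_mult:
  fixes A :: "'a :: field mat"
  assumes "A \<in> carrier_mat n n" "B \<in> carrier_mat n n"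
  shows "vec_space.col_space n (A * B) \<subseteq> vec_space.col_space n A"
proof -
  have AB: "A * B \<in> carrier_mat n n"
    using assms by simp
  show ?thesis
  proof
    fix y assume "y \<in> vec_space.col_space n (A * B)"
    then obtain x where x: "x \<in> carrier_vec n" "A * B *\<^sub>v x = y"
      unfolding vec_space.col_space_eq[OF AB] using AB by auto
    then have "y = A *\<^sub>v (B *\<^sub>v x)"
      using assms by simp
    moreover have "B *\<^sub>v x \<in> carrier_vec n"
      using assms(2) x(1) by simp
    ultimately show "y \<in> vec_space.col_space n A"
      unfolding vec_space.col_space_eq[OF assms(1)] using assms by auto
  qed
qed

text \<open>This serves the case of index 0. By \<open>A * X * A = A\<close>, the product
  \<open>A * X\<close> fixes every vector in the range of \<open>A\<close>; once that range is the
  whole space, it fixes all unit vectors.\<close>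

lemma mult_mat_eq_one_if_surj:
  fixes A :: "'a :: field mat"
  assumes gi: "group_inverse n A X"
    and cs: "vec_space.col_space n (1\<^sub>m n :: 'a mat) = vec_space.col_space n A"
  shows "A * X = 1\<^sub>m n"
proof (rule eq_matI)
  have A [simp]: "A \<in> carrier_mat n n" and X [simp]: "X \<in> carrier_mat n n"
    using gi by (auto simp: group_inverse_def)
  have AX [simp]: "A * X \<in> carrier_mat n n"
    using A X by (rule mult_carrier_mat)
  show "dim_row (A * X) = dim_row (1\<^sub>m n :: 'a mat)" "dim_col (A * X) = dim_col (1\<^sub>m n :: 'a mat)"
    using carrier_matD[OF AX] by simp_all
  fix i j assume "i < dim_row (1\<^sub>m n :: 'a mat)" "j < dim_col (1\<^sub>m n :: 'a mat)"
  then have i: "i < n" and j: "j < n" by simp_all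
  have "unit_vec n j \<in> vec_space.col_space n (1\<^sub>m n :: 'a mat)"
    by (auto simp: vec_space.col_space_eq[OF one_carrier_mat])
  then obtain x where x: "x \<in> carrier_vec n" "A *\<^sub>v x = unit_vec n j"
    unfolding cs vec_space.col_space_eq[OF A] using A by auto
  have AXA: "A * X * A = A"
    using gi unfolding group_inverse_def by blast
  have "(A * X) *\<^sub>v unit_vec n j = (A * X * A) *\<^sub>v x"
    using x by (simp add: assoc_mult_mat_vec[OF AX A])
  also have "\<dots> = unit_vec n j"
    by (simp only: AXA x(2))
  finally have "((A * X) *\<^sub>v unit_vec n j) $ i = unit_vec n j $ i" by simp
  moreover have "(M *\<^sub>v unit_vec n j) $ i = M $$ (i, j)" if "M \<in> carrier_mat n n" for M :: "'a mat"
    using that i j by simp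
  ultimately have "(A * X) $$ (i, j) = unit_vec n j $ i"
    using AX by metis
  then show "(A * X) $$ (i, j) = (1\<^sub>m n :: 'a mat) $$ (i, j)"
    using i j by simp
qed

text \<open>The equation \<open>A = A * A * X\<close> bounds the index by 1. For either possible
  index, the index equation on a commuting candidate \<open>Y\<close> amounts to
  \<open>A * Y * A = A\<close>, so the uniqueness of group inverses applies.\<close>

lemma drazin_inverse_eq_group_inverse:
  fixes A :: "'a :: field mat"
  assumes gi: "group_inverse n A X"
  shows "drazin_inverse A = X"
proof -
  note mult = mult_carrier_mat[of _ n n _ n]
  note assoc = assoc_mult_mat[of _ n n _ n _ n]
  have A [simp]: "A \<in> carrier_mat n n" and X [simp]: "X \<in> carrier_mat n n"
    and AX: "A * X = X * A" "A * X * A = A" "X * A * X = X"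
    using gi by (auto simp: group_inverse_def)
  have dim: "dim_row A = n" using A by (rule carrier_matD)
  have pow2: "A ^\<^sub>m 2 = A * A"
    using A by (simp add: numeral_2_eq_2)
  have "A * A * X = A * (X * A)"
    by (simp only: assoc[OF A A X] AX(1))
  also have "\<dots> = A * X * A"
    by (simp only: assoc[OF A X A])
  finally have A2X: "A * A * X = A"
    by (simp only: AX(2))
  have AA: "A * A \<in> carrier_mat n n" by (simp add: mult)
  define P where "P k \<longleftrightarrow> vec_space.col_space (dim_row A) (A ^\<^sub>m k)
                         = vec_space.col_space (dim_row A) (A ^\<^sub>m (k + 1))" for k
  have index: "mat_index A = (LEAST k. P k)"
    by (simp add: mat_index_def P_def)
  \<comment> \<open>One inclusion holds since \<open>A * A\<close> is a right multiple of
    \<open>A\<close>, the other since \<open>A = A * A * X\<close> is a right multiple of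
    \<open>A * A\<close>.\<close>
  have "P 1"
    using col_space_subset_mult[OF A A] col_space_subset_mult[OF AA X]
    by (simp add: P_def dim pow2 A2X numeral_2_eq_2[symmetric])
  then have "P (mat_index A)" "mat_index A \<le> 1"
    unfolding index by (rule LeastI, rule Least_le)
  then consider "mat_index A = 1" | "mat_index A = 0" "P 0"
    by (cases "mat_index A") auto
  then have main: "A ^\<^sub>m (mat_index A + 1) * Y = A ^\<^sub>m mat_index A \<longleftrightarrow> A * Y * A = A"
    if Y: "Y \<in> carrier_mat n n" and AY: "A * Y = Y * A" for Y
  proof cases
    case 1
    have "A * A * Y = A * (Y * A)"
      by (simp only: assoc[OF A A Y] AY)
    then show ?thesis
      using 1 A by (simp add: pow2 assoc[OF A Y A])
  next
    case 2
    have one: "A * X = 1\<^sub>m n"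
      using \<open>P 0\<close> by (intro mult_mat_eq_one_if_surj[OF gi]) (simp_all add: P_def dim)
    \<comment> \<open>Multiplying by \<open>X\<close> on the right cancels the last factor
      \<open>A\<close>.\<close>
    have "A * Y = 1\<^sub>m n" if "A * Y * A = A"
    proof -
      have "A * Y = A * Y * (A * X)" using one Y by (simp add: mult)
      also have "\<dots> = (A * Y * A) * X" using Y by (simp add: assoc mult)
      finally show ?thesis using one that by simp
    qed
    then show ?thesis
      using 2 by (auto simp: dim left_mult_one_mat[of _ n n])
  qed
  show ?thesis
    unfolding drazin_inverse_def dim
  proof (rule the_equality)
    show "X \<in> carrier_mat n n \<and> A * X = X * A
      \<and> A ^\<^sub>m (mat_index A + 1) * X = A ^\<^sub>m mat_index A \<and> X * A * X = X"
      using main[OF X] AX X by blast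
    show "Y = X" if "Y \<in> carrier_mat n n \<and> A * Y = Y * A
      \<and> A ^\<^sub>m (mat_index A + 1) * Y = A ^\<^sub>m mat_index A \<and> Y * A * Y = Y" for Y
      using that main[of Y] group_inverse_unique[OF gi] by blast
  qed
qed

section \<open>Constructions that produce or preserve group inverses\<close>

text \<open>Passing from \<open>Y\<close> to \<open>Y * A * Y\<close> leaves the products with
  \<open>A\<close> unchanged and enforces the remaining equation
  \<open>X * A * X = X\<close>.\<close>

lemma group_inverse_of_commuting_inner_inverse:
  fixes A :: "'a :: semiring_1 mat"
  assumes [simp]: "A \<in> carrier_mat n n" "Y \<in> carrier_mat n n"
    and AY: "A * Y = Y * A" "A * Y * A = A"
  shows "group_inverse n A (Y * A * Y)"
proof -
  note [simp] = mult_carrier_mat[of _ n n _ n]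
  note assoc = assoc_mult_mat[of _ n n _ n _ n]
  \<comment> \<open>Right-nested forms of \<open>A * Y * A = A\<close>, so that they match terms
    normalised by \<open>assoc\<close>.\<close>
  have R: "A * (Y * A) = A" using AY(2) by (simp add: assoc)
  have R': "A * (Y * (A * C)) = A * C" if "C \<in> carrier_mat n n" for C
    using that R by (metis assms(1,2) assoc mult_carrier_mat)
  have "A * (Y * A * Y) = A * Y" by (simp add: assoc R')
  moreover have "Y * A * Y * A = Y * A" by (simp add: assoc R)
  ultimately show ?thesis
    using AY by (simp add: group_inverse_def assoc R R')
qed

text \<open>The idempotent \<open>E = A * X\<close> is an identity for both \<open>A\<close> and
  \<open>X\<close>. It commutes with \<open>W\<close> because \<open>E * W\<close> and
  \<open>W * E\<close> both equal \<open>E * W * E\<close>, and this carries over to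
  \<open>X\<close>.\<close>

lemma group_inverse_commute:
  fixes A :: "'a :: semiring_1 mat"
  assumes gi: "group_inverse n A X" and [simp]: "W \<in> carrier_mat n n"
    and WA: "W * A = A * W"
  shows "W * X = X * W"
proof -
  note [simp] = mult_carrier_mat[of _ n n _ n]
  note assoc = assoc_mult_mat[of _ n n _ n _ n]
  have [simp]: "A \<in> carrier_mat n n" "X \<in> carrier_mat n n"
    and AX: "A * X = X * A" "A * X * A = A" "X * A * X = X"
    using gi by (auto simp: group_inverse_def)
  define E where "E = A * X"
  have [simp]: "E \<in> carrier_mat n n" by (simp add: E_def)
  have E': "E = X * A" using AX by (simp add: E_def)
  have "E * A = A" "X * E = X" unfolding E_def using AX(2,3) by (simp_all flip: assoc)
  moreover have "A * E = A" "E * X = X" unfolding E' using AX(2,3) by (simp_all flip: assoc)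
  ultimately have EA: "E * A = A" "A * E = A" and EX: "E * X = X" "X * E = X"
    by blast+
  \<comment> \<open>Moving \<open>A\<close> past \<open>W\<close>, replacing it by
    \<open>A * E\<close> and moving it back produces the extra \<open>E\<close> on the right; the
    next chain is the mirror image with \<open>A = E * A\<close>.\<close>
  have "E * W = X * (A * W)" using AX by (simp add: E_def assoc)
  also have "\<dots> = X * (W * (A * E))" using EA WA by simp
  also have "\<dots> = X * (A * W) * E" using WA by (simp flip: assoc)
  also have "\<dots> = E * W * E" using AX by (simp add: E_def assoc)
  finally have 1: "E * W = E * W * E" .
  have "W * E = A * W * X" using WA by (simp add: E_def flip: assoc)
  also have "\<dots> = E * A * W * X" using EA by simp
  also have "\<dots> = E * (W * A) * X" using WA by (simp add: assoc)
  also have "\<dots> = E * W * E" by (simp add: E_def assoc)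
  finally have EW: "E * W = W * E" using 1 by simp
  \<comment> \<open>Inserting \<open>E\<close> supplies a factor \<open>A\<close>, which can pass
    \<open>W\<close>, and a second \<open>X\<close> to its right.\<close>
  have "X * W = X * (E * W)" using EX by (simp flip: assoc)
  also have "\<dots> = X * (W * A) * X" unfolding EW by (simp add: E_def assoc)
  also have "\<dots> = X * A * (W * X)" unfolding WA by (simp add: assoc)
  also have "\<dots> = E * W * X" using AX by (simp add: E_def assoc)
  also have "\<dots> = W * (E * X)" unfolding EW by (simp add: assoc)
  finally show ?thesis using EX by simp
qed

text \<open>Since \<open>W\<close> commutes with \<open>A\<close>, it also commutes with
  \<open>X\<close>. Hence \<open>W\<close> meets \<open>W'\<close> in both products of the new pair,
  and each collapses to \<open>A * X\<close>.\<close>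

lemma group_inverse_mult_invertible:
  fixes A :: "'a :: semiring_1 mat"
  assumes gi: "group_inverse n A X"
    and [simp]: "W \<in> carrier_mat n n" "W' \<in> carrier_mat n n"
    and WW: "W * W' = 1\<^sub>m n" "W' * W = 1\<^sub>m n" and WA: "W * A = A * W"
  shows "group_inverse n (W * A) (W' * X)"
proof -
  note [simp] = mult_carrier_mat[of _ n n _ n]
  note assoc = assoc_mult_mat[of _ n n _ n _ n]
  have [simp]: "A \<in> carrier_mat n n" "X \<in> carrier_mat n n"
    and AX: "A * X = X * A" "A * X * A = A" "X * A * X = X"
    using gi by (auto simp: group_inverse_def)
  have WX: "W * X = X * W" by (rule group_inverse_commute[OF gi _ WA]) simp
  have "W * A * (W' * X) = A * (W * W') * X" using WA by (simp add: assoc)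
  then have 1: "W * A * (W' * X) = A * X" by (simp add: WW right_mult_one_mat[of _ n n])
  have "W' * X * (W * A) = W' * (X * W) * A" by (simp add: assoc)
  also have "\<dots> = (W' * W) * (X * A)" by (simp add: assoc flip: WX)
  finally have 2: "W' * X * (W * A) = A * X" using AX by (simp add: WW left_mult_one_mat[of _ n n])
  have "A * X * (W * A) = A * (X * W) * A" by (simp add: assoc)
  also have "\<dots> = (A * W) * X * A" by (simp add: assoc flip: WX)
  also have "\<dots> = W * (A * X * A)" by (simp add: assoc flip: WA)
  finally have 3: "A * X * (W * A) = W * A" using AX by simp
  have "W' * X * (W * A) * (W' * X) = W' * X * (A * X)"
    using 1 by (simp add: assoc)
  also have "\<dots> = W' * (X * A * X)" by (simp add: assoc)
  finally show ?thesis using 1 2 3 AX by (simp add: group_inverse_def)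
qed

text \<open>The inner factor \<open>V * U\<close> cancels, which makes conjugation multiplicative
  and carries the three equations over.\<close>

lemma group_inverse_similar:
  fixes A :: "'a :: semiring_1 mat"
  assumes gi: "group_inverse n A X"
    and [simp]: "U \<in> carrier_mat n n" "V \<in> carrier_mat n n"
    and VU: "V * U = 1\<^sub>m n"
  shows "group_inverse n (U * A * V) (U * X * V)"
proof -
  note [simp] = mult_carrier_mat[of _ n n _ n]
  note assoc = assoc_mult_mat[of _ n n _ n _ n]
  have [simp]: "A \<in> carrier_mat n n" "X \<in> carrier_mat n n"
    and AX: "A * X = X * A" "A * X * A = A" "X * A * X = X"
    using gi by (auto simp: group_inverse_def)
  have conj: "U * C * V * (U * D * V) = U * (C * D) * V"
    if [simp]: "C \<in> carrier_mat n n" "D \<in> carrier_mat n n" for C D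
  proof -
    have "U * C * V * (U * D * V) = U * C * (V * U) * (D * V)" by (simp add: assoc)
    then show ?thesis unfolding VU by (simp add: assoc left_mult_one_mat[of _ n n])
  qed
  show ?thesis using AX by (simp add: group_inverse_def conj)
qed

section \<open>Matrix powers, geometric sums and roots of unity\<close>

lemma pow_mat_add:
  fixes A :: "'a :: semiring_1 mat"
  assumes [simp]: "A \<in> carrier_mat n n"
  shows "A ^\<^sub>m (k + l) = A ^\<^sub>m k * A ^\<^sub>m l"
proof (induction l)
  case 0
  show ?case using carrier_matD[OF assms] by (simp add: right_mult_one_mat[of _ n n])
next
  case (Suc l)
  then show ?case by (simp add: assoc_mult_mat[of _ n n _ n _ n])
qed

lemma pow_mat_comm:
  fixes A :: "'a :: semiring_1 mat"
  assumes [simp]: "A \<in> carrier_mat n n"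
  shows "A * A ^\<^sub>m k = A ^\<^sub>m k * A"
proof -
  have "A ^\<^sub>m (1 + k) = A ^\<^sub>m 1 * A ^\<^sub>m k"
    by (rule pow_mat_add[OF assms])
  then show ?thesis
    using carrier_matD[OF assms] by simp
qed

lemma smult_mat_assoc: "k \<cdot>\<^sub>m (l \<cdot>\<^sub>m A) = (k * l) \<cdot>\<^sub>m (A :: 'a :: semigroup_mult mat)"
  by (intro eq_matI) (simp_all add: mult.assoc)

text \<open>Here \<open>G\<close> plays the role of the sum of \<open>Q ^ j\<close> over
  \<open>j < k\<close>, and \<open>S\<close> that of the sum of these partial sums for all
  \<open>j < k\<close>. Telescoping gives the equation for \<open>G\<close>; summing it over
  \<open>j\<close> gives the one for \<open>S\<close>.\<close>

lemma geometric_sum_mat: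
  fixes Q :: "'a :: comm_ring_1 mat"
  assumes Q [simp]: "Q \<in> carrier_mat n n"
  shows "\<exists>G S. G \<in> carrier_mat n n \<and> S \<in> carrier_mat n n \<and> Q * G = G * Q \<and> Q * S = S * Q
    \<and> G - Q * G = 1\<^sub>m n - Q ^\<^sub>m k \<and> S - Q * S = of_nat k \<cdot>\<^sub>m 1\<^sub>m n - G"
proof (induction k)
  case 0
  show ?case
    by (rule exI[of _ "0\<^sub>m n n"], rule exI[of _ "0\<^sub>m n n"]) (use carrier_matD[OF Q] in auto)
next
  case (Suc k)
  note [simp] = mult_carrier_mat[of _ n n _ n]
  from Suc obtain G S where car [simp]: "G \<in> carrier_mat n n" "S \<in> carrier_mat n n"
    and comm: "Q * G = G * Q" "Q * S = S * Q"
    and G: "G - Q * G = 1\<^sub>m n - Q ^\<^sub>m k" and S: "S - Q * S = of_nat k \<cdot>\<^sub>m 1\<^sub>m n - G"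
    by blast
  have Qk [simp]: "Q ^\<^sub>m k \<in> carrier_mat n n" by simp
  have dims [simp]: "dim_row Q = n" "dim_col Q = n" "dim_row G = n" "dim_col G = n"
    "dim_row S = n" "dim_col S = n"
    "dim_row (Q ^\<^sub>m k) = n" "dim_col (Q ^\<^sub>m k) = n"
    using carrier_matD[OF Qk] carrier_matD[OF Q] carrier_matD[OF car(1)] carrier_matD[OF car(2)] by simp_all
  have QG: "Q * G \<in> carrier_mat n n" "Q * S \<in> carrier_mat n n" "Q * Q ^\<^sub>m k \<in> carrier_mat n n"
    by simp_all
  \<comment> \<open>Entrywise, the identities become equations in a commutative ring and can be
    added by \<open>algebra_simps\<close>.\<close>
  have G_entry: "G $$ (i, j) - (Q * G) $$ (i, j) = (1\<^sub>m n - Q ^\<^sub>m k) $$ (i, j)"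
    and S_entry: "S $$ (i, j) - (Q * S) $$ (i, j) = (of_nat k \<cdot>\<^sub>m 1\<^sub>m n - G) $$ (i, j)"
    if "i < n" "j < n" for i j
    using that QG unfolding G[symmetric] S[symmetric] by simp_all
  show ?case
  proof (intro exI conjI)
    \<comment> \<open>The witnesses gain one term each: the power \<open>Q ^ k\<close> for the
      geometric sum, and the previous geometric sum \<open>G\<close> for the iterated one.\<close>
    show "G + Q ^\<^sub>m k \<in> carrier_mat n n" "S + G \<in> carrier_mat n n" by simp_all
    show "Q * (G + Q ^\<^sub>m k) = (G + Q ^\<^sub>m k) * Q" "Q * (S + G) = (S + G) * Q"
      using comm pow_mat_comm[OF Q]
      by (simp_all add: mult_add_distrib_mat[of _ n n _ n] add_mult_distrib_mat[of _ n n _ _ n])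
    have "Q * (G + Q ^\<^sub>m k) = Q * G + Q ^\<^sub>m Suc k"
      using pow_mat_comm[OF Q] by (simp add: mult_add_distrib_mat[of _ n n _ n])
    then show "G + Q ^\<^sub>m k - Q * (G + Q ^\<^sub>m k) = 1\<^sub>m n - Q ^\<^sub>m Suc k"
      using G_entry by (intro eq_matI) (auto simp del: index_mult_mat(1) pow_mat_dim simp: algebra_simps)
    have "Q * (S + G) = Q * S + Q * G"
      by (simp add: mult_add_distrib_mat[of _ n n _ n])
    then show "S + G - Q * (S + G) = of_nat (Suc k) \<cdot>\<^sub>m 1\<^sub>m n - (G + Q ^\<^sub>m k)"
      using G_entry S_entry by (intro eq_matI) (auto simp del: index_mult_mat(1) pow_mat_dim simp: algebra_simps)
  qed
qed

text \<open>If \<open>Q ^ k = 1\<close>, the geometric sum annihilates \<open>1 - Q\<close>, and \<open>1 - Q\<close> divides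
  \<open>k - (1 + Q + \<dots> + Q ^ (k - 1))\<close>, so the quotient divided by \<open>k\<close> is an inner inverse.\<close>

lemma inner_inverse_one_minus:
  fixes Q :: "'a :: field_char_0 mat"
  assumes Q [simp]: "Q \<in> carrier_mat n n" and "Q ^\<^sub>m k = 1\<^sub>m n" and "k > 0"
  shows "\<exists>Y. Y \<in> carrier_mat n n \<and> (1\<^sub>m n - Q) * Y = Y * (1\<^sub>m n - Q)
    \<and> (1\<^sub>m n - Q) * Y * (1\<^sub>m n - Q) = 1\<^sub>m n - Q"
proof -
  note [simp] = mult_carrier_mat[of _ n n _ n]
  obtain G S where [simp]: "G \<in> carrier_mat n n" "S \<in> carrier_mat n n"
    and comm: "Q * G = G * Q" "Q * S = S * Q"
    and G: "G - Q * G = 1\<^sub>m n - Q ^\<^sub>m k" and S: "S - Q * S = of_nat k \<cdot>\<^sub>m 1\<^sub>m n - G"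
    using geometric_sum_mat[OF Q] by blast
  define B where "B = 1\<^sub>m n - Q"
  have B [simp]: "B \<in> carrier_mat n n" unfolding B_def by (rule minus_carrier_mat) simp
  have left: "B * C = C - Q * C" and right: "C * B = C - C * Q" if [simp]: "C \<in> carrier_mat n n" for C
    unfolding B_def
    by (simp_all add: minus_mult_distrib_mat[of _ n n _ _ n] mult_minus_distrib_mat[of _ n n _ n]
        left_mult_one_mat[of _ n n] right_mult_one_mat[of _ n n])
  have "G * B = 0\<^sub>m n n"
    using G assms comm by (simp add: right)
  moreover have "(of_nat k \<cdot>\<^sub>m 1\<^sub>m n - G) * B = of_nat k \<cdot>\<^sub>m B - G * B"
    by (simp add: minus_mult_distrib_mat[of _ n n _ _ n] mult_smult_assoc_mat[of _ n n _ n]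
        left_mult_one_mat[of _ n n])
  moreover have "C - 0\<^sub>m n n = C" if "C \<in> carrier_mat n n" for C :: "'a mat"
    using that by (intro eq_matI) auto
  ultimately have "B * S * B = of_nat k \<cdot>\<^sub>m B"
    by (simp add: left S)
  moreover have "B * S = S * B"
    using comm by (simp add: left right)
  \<comment> \<open>Characteristic zero and \<open>k > 0\<close> make \<open>of_nat k\<close>
    invertible.\<close>
  ultimately show ?thesis
    unfolding B_def[symmetric] using \<open>k > 0\<close>
    by (intro exI[of _ "inverse (of_nat k) \<cdot>\<^sub>m S"])
       (auto simp: mult_smult_distrib[of _ n n _ n] mult_smult_assoc_mat[of _ n n _ n] smult_mat_assoc)
qed

text \<open>Factoring out \<open>a\<close> leaves \<open>1 - Q\<close> with
  \<open>Q = (- b / a) P\<close>. The condition \<open>a ^ k = (- b) ^ k\<close> says that the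
  scalar is a \<open>k\<close>-th root of unity, so \<open>Q ^ k = 1\<close>.\<close>

lemma group_inverse_affine_root_of_unity:
  fixes P :: "'a :: field_char_0 mat"
  assumes P [simp]: "P \<in> carrier_mat n n" and Pk: "P ^\<^sub>m k = 1\<^sub>m n" "k > 0"
    and ab: "a \<noteq> 0" "a ^ k = (- b) ^ k"
  shows "\<exists>X. group_inverse n (a \<cdot>\<^sub>m 1\<^sub>m n + b \<cdot>\<^sub>m P) X"
proof -
  note [simp] = mult_carrier_mat[of _ n n _ n]
  define Q where "Q = (- b / a) \<cdot>\<^sub>m P"
  have Q: "Q \<in> carrier_mat n n" by (simp add: Q_def)
  have pow: "Q ^\<^sub>m j = (- b / a) ^ j \<cdot>\<^sub>m P ^\<^sub>m j" for j
    by (induction j)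
      (auto simp: Q_def mult_smult_distrib[of _ n n _ n] mult_smult_assoc_mat[of _ n n _ n]
        smult_mat_assoc mult.commute)
  have "(- b / a) ^ k = (- b) ^ k / a ^ k"
    by (rule power_divide)
  also have "\<dots> = 1"
    unfolding ab(2)[symmetric] using ab(1) by simp
  finally have "(- b / a) ^ k = 1" .
  with pow[of k] Pk have "Q ^\<^sub>m k = 1\<^sub>m n"
    by (auto simp del: divide_minus_left)
  then obtain Y where [simp]: "Y \<in> carrier_mat n n" and Y: "(1\<^sub>m n - Q) * Y = Y * (1\<^sub>m n - Q)"
    "(1\<^sub>m n - Q) * Y * (1\<^sub>m n - Q) = 1\<^sub>m n - Q"
    using inner_inverse_one_minus[OF Q] Pk by blast
  have A: "a \<cdot>\<^sub>m 1\<^sub>m n + b \<cdot>\<^sub>m P = a \<cdot>\<^sub>m (1\<^sub>m n - Q)"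
    using carrier_matD[OF P] ab by (intro eq_matI) (auto simp: Q_def field_simps)
  have B [simp]: "1\<^sub>m n - Q \<in> carrier_mat n n" using Q by (rule minus_carrier_mat)
  show ?thesis
    unfolding A
    \<comment> \<open>The scalar \<open>a\<close> is absorbed by scaling the inner inverse
      \<open>Y\<close> of \<open>1 - Q\<close> with \<open>inverse a\<close>.\<close>
    by (rule exI, rule group_inverse_of_commuting_inner_inverse[where Y = "inverse a \<cdot>\<^sub>m Y"])
      (use Y ab in \<open>auto simp: mult_smult_distrib[of _ n n _ n] mult_smult_assoc_mat[of _ n n _ n]
        smult_mat_assoc\<close>)
qed

section \<open>Kronecker products\<close>

text \<open>Division with remainder identifies \<open>k < p * q\<close> with a pair of block index
  and inner index. This is how the summation in a product of Kronecker products factors.\<close>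

lemma sum_div_mod:
  fixes f g :: "nat \<Rightarrow> 'a :: comm_semiring_0"
  assumes "q > 0"
  shows "(\<Sum>k = 0..<p * q. f (k div q) * g (k mod q)) = (\<Sum>i = 0..<p. f i) * (\<Sum>j = 0..<q. g j)"
proof -
  have "(\<Sum>i = 0..<p. f i) * (\<Sum>j = 0..<q. g j) = (\<Sum>(i, j)\<in>{0..<p} \<times> {0..<q}. f i * g j)"
    by (simp add: sum_product sum.cartesian_product)
  also have "\<dots> = (\<Sum>k = 0..<p * q. f (k div q) * g (k mod q))"
  proof (rule sum.reindex_bij_witness[where i = "\<lambda>k. (k div q, k mod q)" and j = "\<lambda>(i, j). i * q + j"])
    fix x assume "x \<in> {0..<p} \<times> {0..<q}"
    then obtain i j where x: "x = (i, j)" "i < p" "j < q" by auto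
    then have "i * q + j < Suc i * q" by simp
    also have "\<dots> \<le> p * q" using x by (intro mult_le_mono) simp_all
    finally show "(case x of (i, j) \<Rightarrow> i * q + j) \<in> {0..<p * q}" by (simp add: x)
  qed (use assms in \<open>auto simp: less_mult_imp_div_less\<close>)
  finally show ?thesis by simp
qed

lemma kronecker_carrier [simp]:
  "A \<in> carrier_mat p p' \<Longrightarrow> B \<in> carrier_mat q q' \<Longrightarrow> A \<otimes>\<^sub>K B \<in> carrier_mat (p * q) (p' * q')"
  by (auto simp: kronecker_def)

text \<open>The mixed-product property: the middle index splits into quotient and remainder modulo
  \<open>q'\<close>, and the sum becomes a product of two entries.\<close>

lemma kronecker_mult:
  fixes A B C D :: "'a :: comm_semiring_1 mat"
  assumes "A \<in> carrier_mat p p'" "C \<in> carrier_mat p' p''"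
    and "B \<in> carrier_mat q q'" "D \<in> carrier_mat q' q''"
  shows "(A \<otimes>\<^sub>K B) * (C \<otimes>\<^sub>K D) = (A * C) \<otimes>\<^sub>K (B * D)"
proof (rule eq_matI)
  fix i j assume "i < dim_row ((A * C) \<otimes>\<^sub>K (B * D))" "j < dim_col ((A * C) \<otimes>\<^sub>K (B * D))"
  then have i: "i < p * q" and j: "j < p'' * q''" using assms by (simp_all add: kronecker_def)
  then have "q > 0" "q'' > 0" by (auto intro!: gr0I)
  then have ij: "i div q < p" "i mod q < q" "j div q'' < p''" "j mod q'' < q''"
    using i j by (simp_all add: less_mult_imp_div_less)
  have "((A \<otimes>\<^sub>K B) * (C \<otimes>\<^sub>K D)) $$ (i, j)
    = (\<Sum>k = 0..<p' * q'. (A $$ (i div q, k div q') * B $$ (i mod q, k mod q'))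
        * (C $$ (k div q', j div q'') * D $$ (k mod q', j mod q'')))"
    using assms i j by (simp add: kronecker_def scalar_prod_def)
  also have "\<dots> = (\<Sum>k = 0..<p' * q'. (A $$ (i div q, k div q') * C $$ (k div q', j div q''))
        * (B $$ (i mod q, k mod q') * D $$ (k mod q', j mod q'')))"
    by (simp add: ac_simps)
  also have "\<dots> = (\<Sum>k = 0..<p'. A $$ (i div q, k) * C $$ (k, j div q''))
        * (\<Sum>k = 0..<q'. B $$ (i mod q, k) * D $$ (k, j mod q''))"
  \<comment> \<open>For \<open>q' = 0\<close> both sides are zero, as the sum over the middle index
    and the second factor are empty.\<close>
  proof (cases "q' = 0")
    case False
    then show ?thesis
      using sum_div_mod[of q' "\<lambda>k. A $$ (i div q, k) * C $$ (k, j div q'')"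
        "\<lambda>k. B $$ (i mod q, k) * D $$ (k, j mod q'')" p'] by (simp only: neq0_conv)
  qed simp
  also have "\<dots> = ((A * C) \<otimes>\<^sub>K (B * D)) $$ (i, j)"
    using assms i j ij by (simp add: kronecker_def scalar_prod_def)
  finally show "((A \<otimes>\<^sub>K B) * (C \<otimes>\<^sub>K D)) $$ (i, j) = ((A * C) \<otimes>\<^sub>K (B * D)) $$ (i, j)" .
qed (use assms in \<open>auto simp: kronecker_def\<close>)

lemma kronecker_affine:
  fixes A B :: "'a :: comm_semiring_1 mat"
  assumes "A \<in> carrier_mat m m" "B \<in> carrier_mat m m"
  shows "1\<^sub>m d \<otimes>\<^sub>K (a \<cdot>\<^sub>m A + b \<cdot>\<^sub>m B) = a \<cdot>\<^sub>m (1\<^sub>m d \<otimes>\<^sub>K A) + b \<cdot>\<^sub>m (1\<^sub>m d \<otimes>\<^sub>K B)"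
proof (cases "m = 0")
  case False
  then show ?thesis
    using assms by (intro eq_matI) (auto simp: kronecker_def less_mult_imp_div_less algebra_simps)
qed (use assms in \<open>auto simp: kronecker_def\<close>)

section \<open>Permutation matrices and the cyclic shift\<close>

lemma perm_matrix_carrier [simp]: "perm_matrix n \<alpha> \<in> carrier_mat n n"
  by (simp add: perm_matrix_def)

lemma perm_matrix_cong:
  "(\<And>i. i < n \<Longrightarrow> \<alpha> i = \<beta> i) \<Longrightarrow> perm_matrix n \<alpha> = perm_matrix n \<beta>"
  by (auto simp: perm_matrix_def)

lemma perm_matrix_id: "perm_matrix n id = 1\<^sub>m n"
  by (auto simp: perm_matrix_def)

text \<open>Only the middle index \<open>k = \<beta> j\<close> contributes, and the assumption
  places it within the range of summation.\<close>

lemma perm_matrix_mult: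
  assumes "\<And>i. i < n \<Longrightarrow> \<beta> i < n"
  shows "perm_matrix n \<alpha> * perm_matrix n \<beta> = (perm_matrix n (\<alpha> \<circ> \<beta>) :: 'a :: semiring_1 mat)"
proof (rule eq_matI)
  fix i j assume "i < dim_row (perm_matrix n (\<alpha> \<circ> \<beta>) :: 'a mat)" "j < dim_col (perm_matrix n (\<alpha> \<circ> \<beta>) :: 'a mat)"
  then have "i < n" "j < n" by (simp_all add: perm_matrix_def)
  have "(perm_matrix n \<alpha> * perm_matrix n \<beta>) $$ (i, j)
    = (\<Sum>k = 0..<n. (if i = \<alpha> k then 1 else 0 :: 'a) * (if k = \<beta> j then 1 else 0))"
    using \<open>i < n\<close> \<open>j < n\<close> by (simp add: perm_matrix_def scalar_prod_def)
  also have "\<dots> = (\<Sum>k = 0..<n. if k = \<beta> j then (if i = \<alpha> k then 1 else 0 :: 'a) else 0)"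
    by (intro sum.cong) auto
  also have "\<dots> = perm_matrix n (\<alpha> \<circ> \<beta>) $$ (i, j)"
    using assms[OF \<open>j < n\<close>] \<open>i < n\<close> \<open>j < n\<close> by (simp add: perm_matrix_def)
  finally show "(perm_matrix n \<alpha> * perm_matrix n \<beta>) $$ (i, j)
    = (perm_matrix n (\<alpha> \<circ> \<beta>) :: 'a mat) $$ (i, j)" .
qed (auto simp: perm_matrix_def)

lemma perm_matrix_pow:
  assumes "\<And>i. i < n \<Longrightarrow> \<alpha> i < n"
  shows "perm_matrix n \<alpha> ^\<^sub>m k = (perm_matrix n (\<alpha> ^^ k) :: 'a :: semiring_1 mat)"
proof (induction k)
  case 0
  show ?case unfolding pow_mat.simps funpow.simps perm_matrix_id by (simp add: perm_matrix_def)
next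
  case (Suc k)
  show ?case
    by (simp only: pow_mat.simps Suc perm_matrix_mult[OF assms] funpow_Suc_right)
qed

text \<open>The entries are inner products of columns, each a unit vector; injectivity makes
  different columns orthogonal.\<close>

lemma transpose_perm_matrix_mult:
  assumes "inj_on \<alpha> {0..<n}" "\<And>i. i < n \<Longrightarrow> \<alpha> i < n"
  shows "(perm_matrix n \<alpha>)\<^sup>T * perm_matrix n \<alpha> = (1\<^sub>m n :: 'a :: semiring_1 mat)"
proof (rule eq_matI)
  fix i j assume "i < dim_row (1\<^sub>m n :: 'a mat)" "j < dim_col (1\<^sub>m n :: 'a mat)"
  then have ij: "i < n" "j < n" by simp_all
  then have "((perm_matrix n \<alpha>)\<^sup>T * perm_matrix n \<alpha>) $$ (i, j)
    = (\<Sum>k = 0..<n. (if k = \<alpha> i then 1 else 0 :: 'a) * (if k = \<alpha> j then 1 else 0))"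
    by (simp add: perm_matrix_def scalar_prod_def)
  also have "\<dots> = (\<Sum>k = 0..<n. if k = \<alpha> i then (if k = \<alpha> j then 1 else 0 :: 'a) else 0)"
    by (intro sum.cong) auto
  also have "\<dots> = (1\<^sub>m n :: 'a mat) $$ (i, j)"
    using ij assms by (auto dest: inj_onD)
  finally show "((perm_matrix n \<alpha>)\<^sup>T * perm_matrix n \<alpha>) $$ (i, j) = (1\<^sub>m n :: 'a mat) $$ (i, j)" .
qed (auto simp: perm_matrix_def)

lemma cyc_perm_less: "0 < n \<Longrightarrow> cyc_perm n i < n"
  by (simp add: cyc_perm_def nat_less_iff)

lemma cyc_perm_funpow: "0 < n \<Longrightarrow> i < n \<Longrightarrow> (cyc_perm n ^^ k) i = nat ((int i - int k) mod int n)"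
proof (induction k)
  case (Suc k)
  then have "(cyc_perm n ^^ Suc k) i = nat (((int i - int k) mod int n - 1) mod int n)"
    using cyc_perm_def[of n "(cyc_perm n ^^ k) i"] by simp
  also have "((int i - int k) mod int n - 1) mod int n = (int i - int (Suc k)) mod int n"
    by (simp add: mod_simps algebra_simps)
  finally show ?case .
qed simp

lemma cyc_matrix_carrier [simp]: "cyc_matrix n \<in> carrier_mat n n"
  by (simp add: cyc_matrix_def)

lemma cyc_matrix_pow:
  assumes "0 < n"
  shows "cyc_matrix n ^\<^sub>m k = (perm_matrix n (\<lambda>i. nat ((int i - int k) mod int n)) :: 'a :: semiring_1 mat)"
proof -
  have "cyc_matrix n ^\<^sub>m k = (perm_matrix n (cyc_perm n ^^ k) :: 'a mat)"
    unfolding cyc_matrix_def using assms by (intro perm_matrix_pow cyc_perm_less)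
  then show ?thesis
    using assms by (simp add: cyc_perm_funpow cong: perm_matrix_cong)
qed

lemma cyc_matrix_pow_self: "cyc_matrix n ^\<^sub>m n = (1\<^sub>m n :: 'a :: semiring_1 mat)"
proof (cases "n = 0")
  case False
  then show ?thesis
    by (simp add: cyc_matrix_pow flip: perm_matrix_id cong: perm_matrix_cong)
qed (simp add: carrier_matD[OF cyc_matrix_carrier])

section \<open>The permutation sigma and the intertwining relation\<close>

lemma sigma_perm_less: "0 < n \<Longrightarrow> sigma_perm n s i < n"
  by (simp add: sigma_perm_def F_hat_def J_map_def)

text \<open>For \<open>i < n\<close> the set under the maximum is an initial segment ending at the
  quotient, which lies below \<open>gcd n s\<close> because
  \<open>n = gcd n s * cofactor_gcd n s\<close>.\<close>

lemma rho_eq: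
  assumes "i < n"
  shows "rho n s i = i div cofactor_gcd n s"
proof -
  define m where "m = cofactor_gcd n s"
  have n: "n = gcd n s * m" and "0 < m"
    using assms by (auto simp: m_def cofactor_gcd_def div_greater_zero_iff)
  have "{k \<in> {0..<gcd n s}. i \<ge> k * m} = {..i div m}"
    using assms n \<open>0 < m\<close>
    by (auto simp: less_eq_div_iff_mult_less_eq less_mult_imp_div_less intro: le_less_trans)
  then show ?thesis
    unfolding rho_def m_def[symmetric] by (simp add: Max_eq_iff)
qed

lemma sigma_perm_eq:
  assumes "i < n"
  shows "sigma_perm n s i = (s * (i mod cofactor_gcd n s) + i div cofactor_gcd n s) mod n"
  using assms by (simp add: sigma_perm_def F_hat_def J_map_def ell_def rho_eq minus_div_mult_eq_mod)

text \<open>The value is \<open>s * y + x\<close> modulo \<open>n = d * m\<close>, with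
  \<open>x = i div m\<close> and \<open>y = i mod m\<close>. Since \<open>d\<close> divides
  \<open>s\<close>, reduction modulo \<open>d\<close> reveals \<open>x\<close>; cancelling
  \<open>x\<close> and \<open>d\<close> leaves \<open>t * y\<close> modulo \<open>m\<close>, with
  \<open>t\<close> invertible there.\<close>

lemma inj_on_sigma_perm: "inj_on (sigma_perm n s) {0..<n}"
proof (rule inj_onI)
  define d m t where "d = gcd n s" and "m = cofactor_gcd n s" and "t = s div d"
  fix i j assume ij: "i \<in> {0..<n}" "j \<in> {0..<n}" and eq: "sigma_perm n s i = sigma_perm n s j"
  then have "0 < d" by (auto simp: d_def)
  have n: "n = d * m" and s: "s = d * t" 
    by (simp_all add: d_def m_def t_def cofactor_gcd_def)
  have "0 < m" using ij n by (auto intro!: gr0I)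
  have "coprime (n div gcd n s) (s div gcd n s)"
    using ij by (intro div_gcd_coprime) auto
  then have "coprime t m"
    unfolding m_def t_def d_def cofactor_gcd_def by (simp only: coprime_commute)
  have lt: "i div m < d" "j div m < d" "i mod m < m" "j mod m < m"
    using ij n \<open>0 < m\<close> by (simp_all add: less_mult_imp_div_less)
  have cong: "[s * (i mod m) + i div m = s * (j mod m) + j div m] (mod n)"
    using eq ij by (simp add: cong_def sigma_perm_eq m_def)
  then have "[s * (i mod m) + i div m = s * (j mod m) + j div m] (mod d)"
    by (rule cong_dvd_modulus_nat) (simp add: n)
  then have "[i div m = j div m] (mod d)"
    unfolding s mult.assoc cong_def by simp
  then have div_eq: "i div m = j div m"
    using lt by (simp add: cong_def)
  then have "[d * (t * (i mod m)) = d * (t * (j mod m))] (mod d * m)"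
    using cong unfolding div_eq cong_add_rcancel_nat by (simp only: s n mult.assoc)
  then have "[t * (i mod m) = t * (j mod m)] (mod m)"
    unfolding cong_def mult_mod_right[symmetric] using \<open>0 < d\<close> by simp
  then have "[i mod m = j mod m] (mod m)"
    unfolding cong_mult_lcancel_nat[OF \<open>coprime t m\<close>] .
  then have "i mod m = j mod m" by (simp add: cong_def)
  with div_eq show "i = j"
    using div_mult_mod_eq[of i m] div_mult_mod_eq[of j m] by metis
qed

text \<open>The matrix is block diagonal, so the quotient by \<open>m\<close> (the block) is kept
  and the remainder is shifted cyclically.\<close>

lemma kronecker_cyc_matrix:
  assumes "0 < m"
  shows "1\<^sub>m d \<otimes>\<^sub>K cyc_matrix m
    = (perm_matrix (d * m) (\<lambda>i. i div m * m + cyc_perm m (i mod m)) :: 'a :: semiring_1 mat)"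
proof (rule eq_matI)
  fix i j
  assume "i < dim_row (perm_matrix (d * m) (\<lambda>i. i div m * m + cyc_perm m (i mod m)) :: 'a mat)"
    "j < dim_col (perm_matrix (d * m) (\<lambda>i. i div m * m + cyc_perm m (i mod m)) :: 'a mat)"
  then have ij: "i < d * m" "j < d * m" by (simp_all add: perm_matrix_def)
  have "i = j div m * m + c \<longleftrightarrow> i div m = j div m \<and> i mod m = c" if "c < m" for c
  proof
    assume "i div m = j div m \<and> i mod m = c"
    then show "i = j div m * m + c" using div_mult_mod_eq[of i m] by metis
  qed (use that in simp)
  from this[OF cyc_perm_less[OF assms]] show "(1\<^sub>m d \<otimes>\<^sub>K cyc_matrix m) $$ (i, j)
    = (perm_matrix (d * m) (\<lambda>i. i div m * m + cyc_perm m (i mod m)) :: 'a mat) $$ (i, j)"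
    using ij assms
    by (simp add: kronecker_def cyc_matrix_def perm_matrix_def less_mult_imp_div_less)
qed (simp_all add: kronecker_def cyc_matrix_def perm_matrix_def)

text \<open>\<open>P ^ s\<close> subtracts \<open>s\<close> from an index, which turns
  \<open>s * y + x\<close> into \<open>s * (y - 1) + x\<close>. In the coordinates
  \<open>(x, y)\<close> this is the cyclic shift of \<open>y\<close> within block
  \<open>x\<close>.\<close>

lemma cyc_matrix_pow_sigma:
  fixes n s :: nat
  defines "m \<equiv> cofactor_gcd n s" and "d \<equiv> gcd n s"
  assumes "0 < n"
  shows "cyc_matrix n ^\<^sub>m s * perm_matrix n (sigma_perm n s)
    = perm_matrix n (sigma_perm n s) * (1\<^sub>m d \<otimes>\<^sub>K cyc_matrix m :: 'a :: semiring_1 mat)"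
proof -
  have n: "n = d * m" by (simp add: d_def m_def cofactor_gcd_def)
  then have "0 < m" using \<open>0 < n\<close> by (auto intro!: gr0I)
  \<comment> \<open>This permits reducing \<open>y\<close> modulo \<open>m\<close> inside
    \<open>s * y\<close> without changing the value modulo \<open>n\<close>.\<close>
  have "n dvd s * m"
    unfolding n by (intro mult_dvd_mono) (simp_all add: d_def)
  then have "int n dvd int s * int m"
    by (simp flip: of_nat_mult)
  define \<pi> where "\<pi> = (\<lambda>i. i div m * m + cyc_perm m (i mod m))"
  have \<pi>_less: "\<pi> i < n" if "i < n" for i
  proof -
    have "\<pi> i < Suc (i div m) * m" using cyc_perm_less[OF \<open>0 < m\<close>] by (simp add: \<pi>_def)
    also have "\<dots> \<le> d * m"
      using that n by (intro mult_le_mono) (simp_all add: Suc_le_eq less_mult_imp_div_less)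
    finally show ?thesis using n by simp
  qed
  have "nat ((int (sigma_perm n s i) - int s) mod int n) = sigma_perm n s (\<pi> i)" if i: "i < n" for i
  proof -
    have \<pi>_div: "\<pi> i div m = i div m" "\<pi> i mod m = cyc_perm m (i mod m)"
      using cyc_perm_less[OF \<open>0 < m\<close>] \<open>0 < m\<close> by (simp_all add: \<pi>_def)
    define c where "c = cyc_perm m (i mod m)"
    \<comment> \<open>A congruence rather than an equation: at remainder 0 the shift wraps around to
      \<open>m - 1\<close>.\<close>
    have "[int c = int (i mod m) - 1] (mod int m)"
      using \<open>0 < m\<close> by (simp add: c_def cyc_perm_def cong_def)
    then have "int m dvd int c - (int (i mod m) - 1)" by (simp add: cong_iff_dvd_diff)
    then have "int s * int m dvd int s * (int c - (int (i mod m) - 1))" by simp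
    then have "int n dvd int s * (int c - (int (i mod m) - 1))"
      using \<open>int n dvd int s * int m\<close> dvd_trans by blast
    then have "[int s * int c = int s * (int (i mod m) - 1)] (mod int n)"
      by (simp add: cong_iff_dvd_diff right_diff_distrib)
    then have "[int s * int c + int (i div m) = int s * (int (i mod m) - 1) + int (i div m)] (mod int n)"
      by (rule cong_add) simp
    then have "(int (sigma_perm n s i) - int s) mod int n = (int s * int c + int (i div m)) mod int n"
      using i by (simp add: cong_def sigma_perm_eq zmod_int mod_simps algebra_simps flip: m_def)
    also have "\<dots> = int (sigma_perm n s (\<pi> i))"
      using \<pi>_less[OF i] by (simp add: sigma_perm_eq \<pi>_div c_def zmod_int flip: m_def)
    finally show ?thesis by simp
  qed
  then have "perm_matrix n ((\<lambda>i. nat ((int i - int s) mod int n)) \<circ> sigma_perm n s)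
    = (perm_matrix n (sigma_perm n s \<circ> \<pi>) :: 'a mat)"
    by (intro perm_matrix_cong) simp
  then have "perm_matrix n (\<lambda>i. nat ((int i - int s) mod int n)) * perm_matrix n (sigma_perm n s)
    = (perm_matrix n (sigma_perm n s) * perm_matrix n \<pi> :: 'a mat)"
    by (simp only: perm_matrix_mult[OF sigma_perm_less[OF \<open>0 < n\<close>]] perm_matrix_mult[OF \<pi>_less])
  moreover have "1\<^sub>m d \<otimes>\<^sub>K cyc_matrix m = (perm_matrix n \<pi> :: 'a mat)"
    unfolding \<pi>_def n by (rule kronecker_cyc_matrix[OF \<open>0 < m\<close>])
  ultimately show ?thesis
    by (simp only: cyc_matrix_pow[OF \<open>0 < n\<close>])
qed

section \<open>Transfer to the block diagonal matrix and assembly of the formula\<close>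

text \<open>By the mixed-product property, the Kronecker product with an identity on the left is
  multiplicative in the right factor, so each defining equation transfers.\<close>

lemma group_inverse_kronecker_one:
  fixes A :: "'a :: comm_semiring_1 mat"
  assumes "group_inverse m A X"
  shows "group_inverse (d * m) (1\<^sub>m d \<otimes>\<^sub>K A) (1\<^sub>m d \<otimes>\<^sub>K X)"
proof -
  have [simp]: "A \<in> carrier_mat m m" "X \<in> carrier_mat m m"
    using assms by (auto simp: group_inverse_def)
  have mult: "(1\<^sub>m d \<otimes>\<^sub>K C) * (1\<^sub>m d \<otimes>\<^sub>K D) = 1\<^sub>m d \<otimes>\<^sub>K (C * D)"
    if "C \<in> carrier_mat m m" "D \<in> carrier_mat m m" for C D :: "'a mat"
    using kronecker_mult[OF one_carrier_mat one_carrier_mat that] by simp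
  have AX: "A * X = X * A" "A * X * A = A" "X * A * X = X"
    using assms by (auto simp: group_inverse_def)
  have "A * X \<in> carrier_mat m m" "X * A \<in> carrier_mat m m"
    by (simp_all add: mult_carrier_mat[of _ m m _ m])
  then have "(1\<^sub>m d \<otimes>\<^sub>K A) * (1\<^sub>m d \<otimes>\<^sub>K X) * (1\<^sub>m d \<otimes>\<^sub>K A) = 1\<^sub>m d \<otimes>\<^sub>K (A * X * A)"
    "(1\<^sub>m d \<otimes>\<^sub>K X) * (1\<^sub>m d \<otimes>\<^sub>K A) * (1\<^sub>m d \<otimes>\<^sub>K X) = 1\<^sub>m d \<otimes>\<^sub>K (X * A * X)"
    "(1\<^sub>m d \<otimes>\<^sub>K A) * (1\<^sub>m d \<otimes>\<^sub>K X) = 1\<^sub>m d \<otimes>\<^sub>K (A * X)"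
    "(1\<^sub>m d \<otimes>\<^sub>K X) * (1\<^sub>m d \<otimes>\<^sub>K A) = 1\<^sub>m d \<otimes>\<^sub>K (X * A)"
    by (simp_all add: mult)
  note products = this[unfolded AX(2,3)]
  show ?thesis
    unfolding group_inverse_def
  proof (intro conjI)
    show "(1\<^sub>m d \<otimes>\<^sub>K A) * (1\<^sub>m d \<otimes>\<^sub>K X) = (1\<^sub>m d \<otimes>\<^sub>K X) * (1\<^sub>m d \<otimes>\<^sub>K A)"
      unfolding products(3,4) AX(1) ..
  qed (simp, simp, rule products(1), rule products(2))
qed

lemma kronecker_one_one: "1\<^sub>m d \<otimes>\<^sub>K 1\<^sub>m m = (1\<^sub>m (d * m) :: 'a :: semiring_1 mat)"
proof (cases "m = 0")
  case False
  have "i div m = j div m \<and> i mod m = j mod m \<longleftrightarrow> i = j" for i j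
    using div_mult_mod_eq[of i m] div_mult_mod_eq[of j m] by metis
  with False show ?thesis
    by (intro eq_matI) (auto simp: kronecker_def less_mult_imp_div_less)
qed (auto simp: kronecker_def)

theorem theorem6p2:
  fixes n s1 s2 s d m :: nat and a b :: complex
  assumes "s1 < s2" and "s2 < n"
    and "s = s2 - s1" and "d = gcd n s" and "m = cofactor_gcd n s"
    and "a \<noteq> 0" and "b \<noteq> 0"
    and "a ^ m - (- b) ^ m = 0"
  shows "drazin_inverse (a \<cdot>\<^sub>m (cyc_matrix n ^\<^sub>m s1) + b \<cdot>\<^sub>m (cyc_matrix n ^\<^sub>m s2))
    = (cyc_matrix n ^\<^sub>m (n - s1)) * perm_matrix n (sigma_perm n s)
      * (1\<^sub>m d \<otimes>\<^sub>K drazin_inverse (a \<cdot>\<^sub>m 1\<^sub>m m + b \<cdot>\<^sub>m cyc_matrix m))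
      * (perm_matrix n (sigma_perm n s))\<^sup>T"
proof -
  define P :: "complex mat" where "P = cyc_matrix n"
  define U :: "complex mat" where "U = perm_matrix n (sigma_perm n s)"
  define B where "B = a \<cdot>\<^sub>m 1\<^sub>m m + b \<cdot>\<^sub>m cyc_matrix m"
  \<comment> \<open>This is the given matrix with the invertible factor \<open>P ^ s1\<close> taken
    out.\<close>
  define C where "C = a \<cdot>\<^sub>m 1\<^sub>m n + b \<cdot>\<^sub>m P ^\<^sub>m s"
  note mult = mult_carrier_mat[of _ n n _ n]
  note assoc = assoc_mult_mat[of _ n n _ n _ n]
  note smult = mult_smult_distrib[of _ n n _ n] mult_smult_assoc_mat[of _ n n _ n]
  note distrib = mult_add_distrib_mat[of _ n n _ n] add_mult_distrib_mat[of _ n n _ _ n]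
  note one = left_mult_one_mat[of _ n n] right_mult_one_mat[of _ n n]
  have "0 < n" using assms(2) by simp
  have n: "d * m = n"
    by (simp add: assms(4,5) cofactor_gcd_def)
  with \<open>0 < n\<close> have "0 < m" by (auto intro!: gr0I)
  have P: "P \<in> carrier_mat n n" and U: "U \<in> carrier_mat n n" and UT: "U\<^sup>T \<in> carrier_mat n n"
    by (simp_all add: P_def U_def)
  have Pk: "P ^\<^sub>m k \<in> carrier_mat n n" for k
    using P by simp
  have "a ^ m = (- b) ^ m" using assms(8) by simp
  from group_inverse_affine_root_of_unity[OF cyc_matrix_carrier cyc_matrix_pow_self \<open>0 < m\<close> assms(6) this]
  obtain X where X: "group_inverse m B X"
    by (auto simp: B_def)
  then have X_carrier: "X \<in> carrier_mat m m" by (simp add: group_inverse_def)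
  have UTU: "U\<^sup>T * U = 1\<^sub>m n"
    unfolding U_def using inj_on_sigma_perm sigma_perm_less[OF \<open>0 < n\<close>]
    by (rule transpose_perm_matrix_mult)
  then have UUT: "U * U\<^sup>T = 1\<^sub>m n"
    by (rule mat_mult_left_right_inverse[OF UT U])
  have K: "1\<^sub>m d \<otimes>\<^sub>K (cyc_matrix m :: complex mat) \<in> carrier_mat n n" "1\<^sub>m d \<otimes>\<^sub>K X \<in> carrier_mat n n"
    using kronecker_carrier[OF one_carrier_mat cyc_matrix_carrier, of d m]
      kronecker_carrier[OF one_carrier_mat X_carrier, of d] by (simp_all only: n)
  \<comment> \<open>The intertwining relation becomes a similarity on multiplying by the inverse
    \<open>U\<^sup>T\<close> of \<open>U\<close>.\<close>
  have "U * (1\<^sub>m d \<otimes>\<^sub>K cyc_matrix m) * U\<^sup>T = P ^\<^sub>m s * U * U\<^sup>T"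
    using cyc_matrix_pow_sigma[OF \<open>0 < n\<close>, of s, where 'a = complex]
    by (simp only: assms(4,5) U_def P_def)
  also have "\<dots> = P ^\<^sub>m s"
    by (simp only: assoc[OF Pk U UT] UUT right_mult_one_mat[OF Pk])
  finally have conj: "U * (1\<^sub>m d \<otimes>\<^sub>K cyc_matrix m) * U\<^sup>T = P ^\<^sub>m s" .
  have "1\<^sub>m d \<otimes>\<^sub>K B = a \<cdot>\<^sub>m 1\<^sub>m n + b \<cdot>\<^sub>m (1\<^sub>m d \<otimes>\<^sub>K cyc_matrix m)"
    unfolding B_def
    by (simp only: kronecker_affine[OF one_carrier_mat cyc_matrix_carrier] kronecker_one_one n)
  then have C: "U * (1\<^sub>m d \<otimes>\<^sub>K B) * U\<^sup>T = C"
    using U UT K UUT conj by (simp add: C_def smult distrib one mult)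
  have "group_inverse n (1\<^sub>m d \<otimes>\<^sub>K B) (1\<^sub>m d \<otimes>\<^sub>K X)"
    using group_inverse_kronecker_one[OF X, of d] by (simp only: n)
  from group_inverse_similar[OF this U UT UTU]
  have C_inv: "group_inverse n C (U * (1\<^sub>m d \<otimes>\<^sub>K X) * U\<^sup>T)"
    by (simp only: C)
  have pow_sum: "P ^\<^sub>m k * P ^\<^sub>m l = P ^\<^sub>m (k + l)" for k l
    by (rule pow_mat_add[OF P, symmetric])
  \<comment> \<open>As \<open>s1 < n\<close>, the exponents add up to exactly \<open>n\<close>, and
    \<open>P ^ n = 1\<close>.\<close>
  have inv: "P ^\<^sub>m s1 * P ^\<^sub>m (n - s1) = 1\<^sub>m n" "P ^\<^sub>m (n - s1) * P ^\<^sub>m s1 = 1\<^sub>m n"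
    using assms(1,2) cyc_matrix_pow_self[of n, where 'a = complex, folded P_def]
    by (simp_all only: pow_sum) simp_all
  have "P ^\<^sub>m s1 * P ^\<^sub>m s = P ^\<^sub>m s * P ^\<^sub>m s1"
    unfolding pow_sum by (simp only: add.commute)
  then have comm: "P ^\<^sub>m s1 * C = C * P ^\<^sub>m s1"
    using Pk by (simp add: C_def smult distrib one)
  \<comment> \<open>The exponents recombine as \<open>s1 + s = s2\<close>, the subtraction in
    \<open>s\<close> being exact.\<close>
  have "P ^\<^sub>m s1 * C = a \<cdot>\<^sub>m P ^\<^sub>m s1 + b \<cdot>\<^sub>m P ^\<^sub>m s2"
    using Pk assms(1,3) by (simp add: C_def smult distrib one pow_sum)
  with group_inverse_mult_invertible[OF C_inv Pk Pk inv comm]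
  have "drazin_inverse (a \<cdot>\<^sub>m P ^\<^sub>m s1 + b \<cdot>\<^sub>m P ^\<^sub>m s2)
    = P ^\<^sub>m (n - s1) * (U * (1\<^sub>m d \<otimes>\<^sub>K X) * U\<^sup>T)"
    by (intro drazin_inverse_eq_group_inverse) simp
  also have "\<dots> = P ^\<^sub>m (n - s1) * U * (1\<^sub>m d \<otimes>\<^sub>K X) * U\<^sup>T"
    using Pk U UT K by (simp add: assoc mult)
  also have "X = drazin_inverse B"
    using drazin_inverse_eq_group_inverse[OF X] by simp
  finally show ?thesis
    unfolding P_def U_def B_def .
qed

end
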